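(* Let $m\ge 3$. For the problem of minimizing makespan for online job scheduling on $m$ identical machines, every deterministic online algorithm $A$ has online bounded ratio at least $\frac{4}{3}$.
   Context: Jobs with positive sizes arrive online and each must be assigned irrevocably (without preemption) to one of $m$ identical machines; the load of a machine is the total size of its jobs, and the makespan is the maximum load; the goal is to minimize the makespan. For a deterministic online algorithm $A$ of a minimization problem, $\textsc{Opt}_A$ denotes an offline algorithm that is optimal among offline algorithms whose solution on any input $I$ satisfies, for every prefix $I'$ of $I$, that the cost of the solution restricted to $I'$ is at most $A(I')$. The online bounded ratio of $A$ is the infimum of all constants $c$ such that $A(I) \le c\,\textsc{Opt}_A(I)$ for all inputs $I$. *)

theory Defs
  imports Complex_Main "HOL-Library.Sublist" "HOL-Library.Extended_Real"
begin

type_synonym jobs = "real list"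

text \<open>A schedule lists, in order of arrival, the machine each job is assigned to;
  the machines are numbered from \<open>0\<close> to \<open>m - 1\<close>.\<close>

type_synonym schedule = "nat list"

definition inputs :: "jobs set" where
  "inputs = {I. \<forall>p\<in>set I. 0 < p}"

definition schedules :: "nat \<Rightarrow> jobs \<Rightarrow> schedule set" where
  "schedules m I = {s. length s = length I \<and> set s \<subseteq> {..<m}}"

definition load :: "jobs \<Rightarrow> schedule \<Rightarrow> nat \<Rightarrow> real" where
  "load I s j = (\<Sum>i | i < length I \<and> s ! i = j. I ! i)"

definition makespan :: "nat \<Rightarrow> jobs \<Rightarrow> schedule \<Rightarrow> real" where
  "makespan m I s = Max (load I s ` {..<m})"

definition cost :: "nat \<Rightarrow> (jobs \<Rightarrow> schedule) \<Rightarrow> jobs \<Rightarrow> real" where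
  "cost m A I = makespan m I (A I)"

definition offline_algorithm :: "nat \<Rightarrow> (jobs \<Rightarrow> schedule) \<Rightarrow> bool" where
  "offline_algorithm m B \<longleftrightarrow> (\<forall>I\<in>inputs. B I \<in> schedules m I)"

text \<open>Prefix consistency expresses that each job is assigned irrevocably on arrival,
  without knowledge of later jobs.\<close>

definition online_algorithm :: "nat \<Rightarrow> (jobs \<Rightarrow> schedule) \<Rightarrow> bool" where
  "online_algorithm m A \<longleftrightarrow> (\<forall>I\<in>inputs. A I \<in> schedules m I) \<and>
     (\<forall>I\<in>inputs. \<forall>I'. prefix I' I \<longrightarrow> A I' = take (length I') (A I))"

definition bounded_offline_algorithm ::
    "nat \<Rightarrow> (jobs \<Rightarrow> schedule) \<Rightarrow> (jobs \<Rightarrow> schedule) \<Rightarrow> bool" where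
  "bounded_offline_algorithm m A B \<longleftrightarrow> offline_algorithm m B \<and>
     (\<forall>I\<in>inputs. \<forall>I'. prefix I' I \<longrightarrow>
        makespan m I' (take (length I') (B I)) \<le> cost m A I')"

definition optimal_bounded_offline_algorithm ::
    "nat \<Rightarrow> (jobs \<Rightarrow> schedule) \<Rightarrow> (jobs \<Rightarrow> schedule) \<Rightarrow> bool" where
  "optimal_bounded_offline_algorithm m A B \<longleftrightarrow> bounded_offline_algorithm m A B \<and>
     (\<forall>B'. bounded_offline_algorithm m A B' \<longrightarrow> (\<forall>I\<in>inputs. cost m B I \<le> cost m B' I))"

text \<open>Any two optimal algorithms have the same cost on every input, so the choice is immaterial;
  one exists by the lemma \<open>optimal_bounded_Opt\<close> below.\<close>

definition Opt :: "nat \<Rightarrow> (jobs \<Rightarrow> schedule) \<Rightarrow> jobs \<Rightarrow> schedule" where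
  "Opt m A = (SOME B. optimal_bounded_offline_algorithm m A B)"

text \<open>The infimum is taken in the extended reals, so that it would be \<open>\<infinity>\<close> if no constant
  were admissible.\<close>

definition online_bounded_ratio :: "nat \<Rightarrow> (jobs \<Rightarrow> schedule) \<Rightarrow> ereal" where
  "online_bounded_ratio m A =
     Inf {ereal c | c. \<forall>I\<in>inputs. cost m A I \<le> c * cost m (Opt m A) I}"

lemma finite_schedules: "finite (schedules m I)"
proof -
  have "schedules m I = {s. set s \<subseteq> {..<m} \<and> length s = length I}"
    by (auto simp: schedules_def)
  then show ?thesis
    by (simp add: finite_lists_length_eq)
qed

lemma optimal_bounded_Opt:
  assumes "online_algorithm m A"
  shows "optimal_bounded_offline_algorithm m A (Opt m A)"
proof -
  define F where "F I = {s \<in> schedules m I. \<forall>I'. prefix I' I \<longrightarrow>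
    makespan m I' (take (length I') s) \<le> cost m A I'}" for I
  have bounded_iff: "bounded_offline_algorithm m A B \<longleftrightarrow> (\<forall>I\<in>inputs. B I \<in> F I)" for B
    by (auto simp: bounded_offline_algorithm_def offline_algorithm_def F_def)
  have ex: "\<exists>s\<in>F I. \<forall>t\<in>F I. makespan m I s \<le> makespan m I t" if "I \<in> inputs" for I
  proof -
    have "A I \<in> schedules m I"
      using assms that unfolding online_algorithm_def by blast
    moreover have "makespan m I' (take (length I') (A I)) \<le> cost m A I'" if "prefix I' I" for I'
    proof -
      have "A I' = take (length I') (A I)"
        using assms \<open>I \<in> inputs\<close> that unfolding online_algorithm_def by blast
      then show ?thesis
        unfolding cost_def by (metis order_refl)
    qed
    ultimately have "A I \<in> F I"
      unfolding F_def by blast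
    then have "F I \<noteq> {}" by blast
    moreover have "finite (F I)"
      by (simp add: F_def finite_schedules)
    ultimately show ?thesis
      using arg_min_if_finite(1)[of "F I" "makespan m I"] arg_min_least[of "F I" _ "makespan m I"]
      by blast
  qed
  then obtain B where "\<forall>I\<in>inputs. B I \<in> F I \<and> (\<forall>t\<in>F I. makespan m I (B I) \<le> makespan m I t)"
    using bchoice[of inputs "\<lambda>I s. s \<in> F I \<and> (\<forall>t\<in>F I. makespan m I s \<le> makespan m I t)"]
    by blast
  then have "optimal_bounded_offline_algorithm m A B"
    by (simp add: optimal_bounded_offline_algorithm_def bounded_iff cost_def)
  then show ?thesis
    unfolding Opt_def by (rule someI[where P = "optimal_bounded_offline_algorithm m A"])
qed

end

theory Submission
  imports Defs
begin

text \<open>The adversary opens with a job of size \<open>3\<close>. From then on the cost of \<open>A\<close> is at least \<open>3\<close>,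
  so every schedule with final makespan at most \<open>3\<close> is admissible for the offline algorithm.
  After \<open>m - 2\<close> jobs of size \<open>3\<close>, two jobs of size \<open>1\<close> arrive. If \<open>A\<close> puts them on the same
  machine, two jobs of size \<open>2\<close> follow, which fit into makespan \<open>3\<close> only if the unit jobs are
  apart; if \<open>A\<close> separates them, a job of size \<open>3\<close> follows, which fits only if they are together.
  All sizes are integral, so \<open>A\<close> ends with cost at least \<open>4\<close>, against \<open>3\<close> offline.\<close>

section \<open>Loads and makespans of schedules\<close>

lemma load_Nil: "load [] s j = 0"
  by (simp add: load_def)

lemma load_snoc:
  assumes "length s = length I"
  shows "load (I @ [p]) (s @ [x]) j = load I s j + (if x = j then p else 0)"
proof -
  have "{i. i < length (I @ [p]) \<and> (s @ [x]) ! i = j} =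
      {i. i < length I \<and> s ! i = j} \<union> (if x = j then {length I} else {})"
    using assms by (auto simp: nth_append less_Suc_eq)
  moreover have "(\<Sum>i | i < length I \<and> s ! i = j. (I @ [p]) ! i) = load I s j"
    unfolding load_def by (rule sum.cong) (auto simp: nth_append)
  ultimately show ?thesis
    by (simp add: load_def sum.union_disjoint)
qed

lemma load_replicate: "load (replicate (length s) c) s j = c * count_list s j"
proof (induction s rule: rev_induct)
  case Nil
  then show ?case by (simp add: load_Nil)
next
  case (snoc x s)
  have "replicate (length (s @ [x])) c = replicate (length s) c @ [c]"
    by (simp add: replicate_append_same)
  then show ?case
    using snoc by (simp add: load_snoc algebra_simps)
qed

lemma inputs_nth_nonneg: "I \<in> inputs \<Longrightarrow> i < length I \<Longrightarrow> 0 \<le> I ! i"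
  unfolding inputs_def using nth_mem[of i I] by fastforce

lemma load_prefix_le:
  assumes "I \<in> inputs" "prefix I' I" "length s = length I"
  shows "load I' (take (length I') s) j \<le> load I s j"
proof -
  have len: "length I' \<le> length I"
    using assms(2) by (rule prefix_length_le)
  have "load I' (take (length I') s) j = (\<Sum>i | i < length I' \<and> s ! i = j. I ! i)"
    unfolding load_def using assms(2) by (intro sum.cong) (auto simp: prefix_def nth_append)
  also have "\<dots> \<le> load I s j"
    unfolding load_def using len inputs_nth_nonneg[OF assms(1)] by (intro sum_mono2) auto
  finally show ?thesis .
qed

lemma load_le_makespan: "j < m \<Longrightarrow> load I s j \<le> makespan m I s"
  by (simp add: makespan_def)

lemma makespan_le_iff:
  "0 < m \<Longrightarrow> makespan m I s \<le> c \<longleftrightarrow> (\<forall>j<m. load I s j \<le> c)"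
  by (auto simp: makespan_def Max_le_iff lessThan_empty_iff)

lemma online_schedules: "online_algorithm m A \<Longrightarrow> I \<in> inputs \<Longrightarrow> A I \<in> schedules m I"
  unfolding online_algorithm_def by blast

lemma online_take:
  "online_algorithm m A \<Longrightarrow> I \<in> inputs \<Longrightarrow> prefix I' I \<Longrightarrow> A I' = take (length I') (A I)"
  unfolding online_algorithm_def by blast

section \<open>Bounding the offline optimum by the first job\<close>

lemma first_job_le_cost:
  assumes "online_algorithm m A" "P # J \<in> inputs"
  shows "P \<le> cost m A (P # J)"
proof -
  have sch: "A (P # J) \<in> schedules m (P # J)"
    using assms by (rule online_schedules)
  let ?j = "A (P # J) ! 0"
  have "?j < m"
    using sch nth_mem[of 0 "A (P # J)"] by (force simp: schedules_def)
  have "P = (\<Sum>i\<in>{0}. (P # J) ! i)" by simp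
  also have "\<dots> \<le> load (P # J) (A (P # J)) ?j"
    unfolding load_def by (intro sum_mono2 inputs_nth_nonneg[OF assms(2)]) auto
  also have "\<dots> \<le> cost m A (P # J)"
    unfolding cost_def using \<open>?j < m\<close> by (rule load_le_makespan)
  finally show ?thesis .
qed

text \<open>From the first job on, \<open>A\<close> pays at least \<open>P\<close>, while no prefix
  of \<open>t\<close> exceeds \<open>P\<close> because sizes are positive. So \<open>t\<close> meets
  every prefix constraint, and \<open>Opt\<close> does no worse than \<open>t\<close> on
  \<open>I\<close>.\<close>

lemma cost_Opt_le_first_job:
  assumes "0 < m" "online_algorithm m A" "I = P # J" "I \<in> inputs"
    and "t \<in> schedules m I" "makespan m I t \<le> P"
  shows "cost m (Opt m A) I \<le> P"
proof -
  \<comment> \<open>An offline algorithm may treat different inputs independently, so changing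
    \<open>A\<close> at \<open>I\<close> alone is allowed; elsewhere \<open>A\<close> is bounded by
    its own cost.\<close>
  define B where "B = A(I := t)"
  have bounded_A: "makespan m I' (take (length I') (A K)) \<le> cost m A I'"
    if "K \<in> inputs" "prefix I' K" for K I'
    using online_take[OF assms(2) that] by (simp add: cost_def)
  have bounded_t: "makespan m I' (take (length I') t) \<le> cost m A I'" if "prefix I' I" for I'
  proof (cases I')
    case Nil
    then show ?thesis
      using bounded_A[OF assms(4) that] by simp
  next
    case (Cons P' J')
    with that assms(3) have "P' = P" by simp
    have "I' \<in> inputs"
      using assms(4) set_mono_prefix[OF that] by (auto simp: inputs_def)
    have "makespan m I' (take (length I') t) \<le> makespan m I t"
      unfolding makespan_le_iff[OF assms(1)]
      using load_prefix_le[OF assms(4) that, of t] assms(5) load_le_makespan[of _ m I t]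
      by (auto simp: schedules_def intro: order_trans)
    also have "\<dots> \<le> P" by (rule assms(6))
    also have "\<dots> \<le> cost m A I'"
      using first_job_le_cost[OF assms(2)] \<open>I' \<in> inputs\<close> Cons \<open>P' = P\<close> by simp
    finally show ?thesis .
  qed
  have "B K \<in> schedules m K" if "K \<in> inputs" for K
    using assms(5) online_schedules[OF assms(2) that] by (simp add: B_def)
  moreover have "makespan m I' (take (length I') (B K)) \<le> cost m A I'"
    if "K \<in> inputs" "prefix I' K" for K I'
    using bounded_A[OF that] bounded_t that(2) by (simp add: B_def)
  ultimately have "bounded_offline_algorithm m A B"
    by (simp add: bounded_offline_algorithm_def offline_algorithm_def)
  then have "cost m (Opt m A) I \<le> cost m B I"
    using optimal_bounded_Opt[OF assms(2)] assms(4)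
    by (simp add: optimal_bounded_offline_algorithm_def)
  also have "\<dots> \<le> P"
    using assms(6) by (simp add: cost_def B_def)
  finally show ?thesis .
qed

section \<open>The two adversarial inputs\<close>

lemma distinct_if_count_list_less_2:
  assumes "\<And>x. x \<in> set xs \<Longrightarrow> count_list xs x < 2"
  shows "distinct xs"
proof (rule ccontr)
  assume "\<not> distinct xs"
  then obtain as bs cs y where "xs = as @ [y] @ bs @ [y] @ cs"
    using not_distinct_decomp by blast
  then show False
    using assms[of y] by simp
qed

lemma not_distinct_if_length_gt:
  assumes "set xs \<subseteq> {..<m::nat}" "m < length xs"
  shows "\<not> distinct xs"
  using assms card_mono[OF _ assms(1)] distinct_card[of xs] by fastforce

lemma online_append:
  assumes "online_algorithm m A" "I @ J \<in> inputs"
  shows "\<exists>u. A (I @ J) = A I @ u \<and> length u = length J"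
proof (intro exI conjI)
  have "A I = take (length I) (A (I @ J))"
    by (rule online_take[OF assms]) simp
  then show "A (I @ J) = A I @ drop (length I) (A (I @ J))"
    using append_take_drop_id[of "length I" "A (I @ J)"] by argo
  show "length (drop (length I) (A (I @ J))) = length J"
    using online_schedules[OF assms] by (simp add: schedules_def)
qed

definition threes_ones :: "nat \<Rightarrow> jobs" where
  "threes_ones n = replicate n 3 @ [1, 1]"

lemma load_threes_ones:
  assumes "length s = n"
  shows "load (threes_ones n @ [2, 2]) (s @ [a, b, c, d]) j = 3 * real (count_list s j) +
      (if a = j then 1 else 0) + (if b = j then 1 else 0) +
      (if c = j then 2 else 0) + (if d = j then 2 else 0)"
    and "load (threes_ones n @ [3]) (s @ [a, b, c]) j = 3 * real (count_list s j) +
      (if a = j then 1 else 0) + (if b = j then 1 else 0) + (if c = j then 3 else 0)"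
proof -
  have "load (threes_ones n @ [2, 2]) (s @ [a, b, c, d]) j =
      load ((((replicate (length s) 3 @ [1]) @ [1]) @ [2]) @ [2])
        ((((s @ [a]) @ [b]) @ [c]) @ [d]) j"
    using assms by (simp add: threes_ones_def)
  also have "\<dots> = 3 * real (count_list s j) +
      (if a = j then 1 else 0) + (if b = j then 1 else 0) +
      (if c = j then 2 else 0) + (if d = j then 2 else 0)"
    by (simp add: load_snoc load_replicate del: append_assoc)
  finally show "load (threes_ones n @ [2, 2]) (s @ [a, b, c, d]) j = \<dots>" .
  have "load (threes_ones n @ [3]) (s @ [a, b, c]) j =
      load (((replicate (length s) 3 @ [1]) @ [1]) @ [3]) (((s @ [a]) @ [b]) @ [c]) j"
    using assms by (simp add: threes_ones_def)
  also have "\<dots> = 3 * real (count_list s j) +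
      (if a = j then 1 else 0) + (if b = j then 1 else 0) + (if c = j then 3 else 0)"
    by (simp add: load_snoc load_replicate del: append_assoc)
  finally show "load (threes_ones n @ [3]) (s @ [a, b, c]) j = \<dots>" .
qed

text \<open>If both costs were below 4, each of the first \<open>n\<close> jobs would occupy a
  machine alone. The later jobs would share the two remaining machines, and the pigeonhole principle
  rules this out.\<close>

lemma adversary_wins:
  assumes "online_algorithm m A" "m = n + 2"
  shows "4 \<le> cost m A (threes_ones n @ [2, 2]) \<or> 4 \<le> cost m A (threes_ones n @ [3])"
proof (rule ccontr)
  let ?I = "threes_ones n @ [2, 2]" and ?I' = "threes_ones n @ [3]"
  assume "\<not> ?thesis"
  then have less: "cost m A ?I < 4" "cost m A ?I' < 4" by auto
  have inputs: "?I \<in> inputs" "?I' \<in> inputs" "threes_ones n \<in> inputs"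
    by (auto simp: inputs_def threes_ones_def)
  have sch: "A K \<in> schedules m K" if "K \<in> inputs" for K
    using assms(1) that by (rule online_schedules)
  obtain s a b where s: "A (threes_ones n) = s @ [a, b]" "length s = n"
  proof -
    obtain u where u: "A (threes_ones n) = A (replicate n 3) @ u" "length u = 2"
      using online_append[OF assms(1), of "replicate n 3" "[1, 1]"] inputs(3)
      by (auto simp: threes_ones_def)
    then obtain a b where "u = [a, b]"
      by (auto simp: length_Suc_conv numeral_2_eq_2)
    moreover have "length (A (replicate n 3)) = n"
      using sch[of "replicate n 3"] by (auto simp: schedules_def inputs_def)
    ultimately show ?thesis
      using that u by simp
  qed
  \<comment> \<open>The choices \<open>s\<close>, \<open>a\<close>, \<open>b\<close> precede the
    branching, so both continuations share them.\<close>
  obtain c d where I: "A ?I = s @ [a, b, c, d]"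
    using online_append[OF assms(1) inputs(1)] s by (auto simp: length_Suc_conv)
  obtain e where I': "A ?I' = s @ [a, b, e]"
    using online_append[OF assms(1) inputs(2)] s by (auto simp: length_Suc_conv)
  have m: "set (s @ [a, b, c, d, e]) \<subseteq> {..<m}"
    using sch[OF inputs(1)] sch[OF inputs(2)] I I' by (auto simp: schedules_def)
  have L: "3 * real (count_list s j) +
      (if a = j then 1 else 0) + (if b = j then 1 else 0) +
      (if c = j then 2 else 0) + (if d = j then 2 else 0) < 4" if "j < m" for j
    using load_le_makespan[OF that, of ?I "A ?I"] less(1)
    by (simp add: cost_def I load_threes_ones[OF s(2)])
  have L': "3 * real (count_list s j) +
      (if a = j then 1 else 0) + (if b = j then 1 else 0) + (if e = j then 3 else 0) < 4"
    if "j < m" for j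
    using load_le_makespan[OF that, of ?I' "A ?I'"] less(2)
    by (simp add: cost_def I' load_threes_ones[OF s(2)])
  have "count_list s j < 2" if "j \<in> set s" for j
    using L[of j] m that by (auto split: if_splits)
  then have dist: "distinct s"
    by (rule distinct_if_count_list_less_2)
  have notin: "x \<notin> set s" if "x \<in> {a, b, c, d, e}" for x
  proof
    assume "x \<in> set s"
    then have "1 \<le> real (count_list s x)"
      using count_list_0_iff[of s x] by linarith
    moreover have "x < m" using that m by auto
    ultimately show False
      using L[of x] L'[of x] that by (auto split: if_splits)
  qed
  have "e \<noteq> a" "e \<noteq> b" "c \<noteq> d"
    using L'[of e] L[of c] m by (auto split: if_splits)
  \<comment> \<open>Otherwise \<open>a\<close>, \<open>b\<close>, \<open>e\<close> are three
    distinct machines outside the \<open>n\<close> machines of \<open>s\<close>, but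
    \<open>m = n + 2\<close>.\<close>
  have "a = b"
  proof (rule ccontr)
    assume "a \<noteq> b"
    then have "distinct (s @ [a, b, e])"
      using dist notin \<open>e \<noteq> a\<close> \<open>e \<noteq> b\<close> by auto
    moreover have "\<not> distinct (s @ [a, b, e])"
      using m s(2) assms(2) by (intro not_distinct_if_length_gt[of _ m]) auto
    ultimately show False by simp
  qed
  \<comment> \<open>Machine \<open>a\<close> already has load 2 from the unit jobs, so a job of size
    2 would raise it to 4.\<close>
  then have "a \<noteq> c" "a \<noteq> d"
    using L[of a] m by (auto split: if_splits)
  then have "distinct (s @ [a, c, d])"
    using dist notin \<open>c \<noteq> d\<close> by auto
  moreover have "\<not> distinct (s @ [a, c, d])"
    using m s(2) assms(2) by (intro not_distinct_if_length_gt[of _ m]) auto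
  ultimately show False by simp
qed

text \<open>Here \<open>m\<close> being at least 3 enters: \<open>0 < n\<close> makes the first job
  have size 3.\<close>

lemma cost_Opt_threes_ones:
  assumes "online_algorithm m A" "m = n + 2" "0 < n"
  shows "cost m (Opt m A) (threes_ones n @ [2, 2]) \<le> 3"
    and "cost m (Opt m A) (threes_ones n @ [3]) \<le> 3"
proof -
  have count: "count_list [0..<n] j = (if j < n then 1 else 0)" for j
    by (induction n) auto
  obtain k where k: "n = Suc k"
    using assms(3) gr0_implies_Suc by blast
  have Cons: "threes_ones n @ K = 3 # (replicate k 3 @ [1, 1] @ K)" for K
    by (simp add: threes_ones_def k)
  \<comment> \<open>Machines \<open>n\<close> and \<open>n + 1\<close> each get one unit job and one
    job of size 2.\<close>
  have "makespan m (threes_ones n @ [2, 2]) ([0..<n] @ [n, n + 1, n, n + 1]) \<le> 3"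
    using assms(2) by (simp add: makespan_le_iff load_threes_ones count)
  then show "cost m (Opt m A) (threes_ones n @ [2, 2]) \<le> 3"
    using assms(1,2)
    by (intro cost_Opt_le_first_job[OF _ _ Cons])
      (auto simp: inputs_def schedules_def threes_ones_def)
  \<comment> \<open>The unit jobs share machine \<open>n\<close>, leaving \<open>n + 1\<close> for
    the last job.\<close>
  have "makespan m (threes_ones n @ [3]) ([0..<n] @ [n, n, n + 1]) \<le> 3"
    using assms(2) by (simp add: makespan_le_iff load_threes_ones count)
  then show "cost m (Opt m A) (threes_ones n @ [3]) \<le> 3"
    using assms(1,2)
    by (intro cost_Opt_le_first_job[OF _ _ Cons])
      (auto simp: inputs_def schedules_def threes_ones_def)
qed

theorem theorem5:
  fixes m :: nat and A :: "jobs \<Rightarrow> schedule"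
  assumes "m \<ge> 3" and "online_algorithm m A"
  shows "online_bounded_ratio m A \<ge> ereal (4 / 3)"
proof -
  define n where "n = m - 2"
  have n: "m = n + 2" "0 < n"
    using assms(1) by (auto simp: n_def)
  obtain I where I: "I \<in> inputs" "4 \<le> cost m A I" "cost m (Opt m A) I \<le> 3"
  proof -
    have "threes_ones n @ [2, 2] \<in> inputs" "threes_ones n @ [3] \<in> inputs"
      by (auto simp: inputs_def threes_ones_def)
    then show ?thesis
      using that adversary_wins[OF assms(2) n(1)] cost_Opt_threes_ones[OF assms(2) n] by blast
  qed
  \<comment> \<open>The admissible constants range over all reals. This sign excludes negative
    \<open>c\<close>, so that the bound 3 may be multiplied by \<open>c\<close>.\<close>
  have "0 \<le> cost m (Opt m A) I"
  proof -
    have "0 \<le> load I (Opt m A I) 0"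
      unfolding load_def using inputs_nth_nonneg[OF I(1)] by (intro sum_nonneg) auto
    then show ?thesis
      using load_le_makespan[of 0 m I "Opt m A I"] n by (simp add: cost_def)
  qed
  have "4 / 3 \<le> c" if "\<forall>I\<in>inputs. cost m A I \<le> c * cost m (Opt m A) I" for c
  proof -
    have le: "4 \<le> c * cost m (Opt m A) I"
      using that I by force
    then have "0 \<le> c"
      using \<open>0 \<le> cost m (Opt m A) I\<close> by (smt (verit) mult_nonpos_nonneg)
    then have "c * cost m (Opt m A) I \<le> c * 3"
      using I(3) by (rule mult_left_mono[rotated])
    with le show ?thesis by simp
  qed
  then show ?thesis
    by (auto simp: online_bounded_ratio_def intro!: Inf_greatest)
qed

end
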